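(* Let $H$ be a real Hilbert space, let $P$ be an orthogonal projector in $H$ with null-space $\mathbf N$ and range $\mathbf P=\mathbf N^\perp$, let $P^\perp=I-P$, and let $A:H\to H$ be a bounded linear operator with $A=A^*\ge 0$. For $f,g\in H$ consider the problem of finding $\sigma\in H$ such that $P^\perp(A\sigma-g)=0$ and $P(\sigma-f)=0$. Then the condition $$\text{there is a finite constant }\rho>0\text{ such that }(A\varepsilon,\varepsilon)\ge \tfrac1\rho\|\varepsilon\|^2\ \text{ for all }\varepsilon\in P^\perp\mathbf R(A)$$ is necessary and sufficient for the following: for all $f\in H$ and all $g\in\mathbf R(A)+\mathbf P$, the normal solution $\sigma$ of the problem, with $P^\perp\sigma\in P^\perp\mathbf R(A)$, exists, is unique, and is continuous in $f\in H$ and $g\in \mathbf R(A)+\mathbf P$. Moreover, if $\rho>0$ is a finite constant such that $(A\varepsilon,\varepsilon)\ge \tfrac1\rho\|\varepsilon\|^2$ for all $\varepsilon\in P^\perp\mathbf R(A)$, then for all $f\in H$ and $g\in\mathbf R(A)+\mathbf P$ the normal solution satisfies $$\|\sigma\|^2\le\|f\|^2+\rho^2\|g-APf\|^2 .$$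
   Context: $\mathbf R(A)$ denotes the range of $A$, and $P^\perp\mathbf R(A)=\{P^\perp A x: x\in H\}$. A "subspace" is a linear manifold, not necessarily closed. The normal solution of the problem for given $f,g$ is the solution of minimal norm in $H$. *)

theory Defs
  imports "HOL-Analysis.Analysis"
begin

definition null_space :: "('a::real_inner \<Rightarrow> 'a) \<Rightarrow> 'a set" where
  "null_space P = {x. P x = 0}"

definition orthogonal_projector :: "('a::real_inner \<Rightarrow> 'a) \<Rightarrow> bool" where
  "orthogonal_projector P \<longleftrightarrow>
     bounded_linear P \<and> P \<circ> P = P \<and> range P = orthogonal_comp (null_space P)"

definition perp_proj :: "('a::real_inner \<Rightarrow> 'a) \<Rightarrow> 'a \<Rightarrow> 'a" where
  "perp_proj P x = x - P x"

(* For a bounded operator on a Hilbert space this is A = A*. It is stated by the defining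
   identity of A* because the library constant adjoint is a choice term, which
   means something only once an adjoint is known to exist. *)
definition self_adjoint :: "('a::real_inner \<Rightarrow> 'a) \<Rightarrow> bool" where
  "self_adjoint A \<longleftrightarrow> (\<forall>x y. A x \<bullet> y = x \<bullet> A y)"

lemma self_adjoint_imp_adjoint_eq: "self_adjoint A \<Longrightarrow> adjoint A = A"
  unfolding self_adjoint_def by (rule adjoint_unique)

definition nonneg_op :: "('a::real_inner \<Rightarrow> 'a) \<Rightarrow> bool" where
  "nonneg_op A \<longleftrightarrow> (\<forall>x. 0 \<le> A x \<bullet> x)"

definition is_solution ::
  "('a::real_inner \<Rightarrow> 'a) \<Rightarrow> ('a \<Rightarrow> 'a) \<Rightarrow> 'a \<Rightarrow> 'a \<Rightarrow> 'a \<Rightarrow> bool" where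
  "is_solution A P f g \<sigma> \<longleftrightarrow> perp_proj P (A \<sigma> - g) = 0 \<and> P (\<sigma> - f) = 0"

definition is_normal_solution ::
  "('a::real_inner \<Rightarrow> 'a) \<Rightarrow> ('a \<Rightarrow> 'a) \<Rightarrow> 'a \<Rightarrow> 'a \<Rightarrow> 'a \<Rightarrow> bool" where
  "is_normal_solution A P f g \<sigma> \<longleftrightarrow> is_arg_min norm (is_solution A P f g) \<sigma>"

(* Arbitrary unless exactly one normal solution exists. *)
definition normal_solution ::
  "('a::real_inner \<Rightarrow> 'a) \<Rightarrow> ('a \<Rightarrow> 'a) \<Rightarrow> 'a \<Rightarrow> 'a \<Rightarrow> 'a" where
  "normal_solution A P f g = (THE \<sigma>. is_normal_solution A P f g \<sigma>)"

definition coercive_on :: "('a::real_inner \<Rightarrow> 'a) \<Rightarrow> 'a set \<Rightarrow> real \<Rightarrow> bool" where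
  "coercive_on A M \<rho> \<longleftrightarrow> (\<forall>\<epsilon>\<in>M. A \<epsilon> \<bullet> \<epsilon> \<ge> 1 / \<rho> * (norm \<epsilon>)\<^sup>2)"

end

theory Submission
  imports Defs
begin

text \<open>
  Write \<open>Q = P\<^sup>\<bottom>\<close>, \<open>N\<close> for the null space of \<open>P\<close> (the range of \<open>Q\<close>) and
  \<open>M = Q R(A)\<close>. A solution has the form \<open>\<sigma> = P f + h\<close> with \<open>h \<in> N\<close>, and the remaining equation is
  \<open>Q A h = Q (g - A P f)\<close>, whose right-hand side lies in \<open>M\<close>. So the problem is about the
  operator \<open>B = Q A\<close>, which is symmetric and nonnegative on \<open>N\<close> and maps into \<open>M\<close>.

  Solutions for the same data differ by some \<open>d \<in> N\<close> with \<open>Q A d = 0\<close>. Then \<open>(A d, d) = 0\<close>, so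
  \<open>A d = 0\<close> because \<open>A \<ge> 0\<close>, and therefore \<open>d\<close> is orthogonal to \<open>R(A)\<close>, to \<open>R(P)\<close> and to \<open>M\<close>.
  By Pythagoras, a solution whose \<open>N\<close>-component lies in \<open>M\<close> is the unique normal solution
  (\<open>is_normal_solution_iff_eq\<close>). Everything thus reduces to solving \<open>B h = m\<close> with \<open>h\<close> and \<open>m\<close> in \<open>M\<close>.

  If \<open>A\<close> is coercive on \<open>M\<close>, it is coercive on the closure of \<open>M\<close>, where the Lax-Milgram
  argument (\<open>coercive_imp_surj_on\<close>) solves \<open>B h = m\<close>; since \<open>B\<close> has its values in \<open>M\<close>, this also
  shows that \<open>M\<close> was closed. Testing the equation with \<open>h\<close> gives \<open>\<parallel>h\<parallel> \<le> \<rho> \<parallel>g - A P f\<parallel>\<close>, hence the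
  norm bound, and by linearity continuity in the data.

  Conversely, well-posedness with \<open>f = 0\<close> makes \<open>B\<close> a bijection of \<open>M\<close>, and continuity at the origin
  gives \<open>\<parallel>k\<parallel> \<le> C \<parallel>B k\<parallel>\<close> on \<open>M\<close>. A lower bound on the norm of \<open>B k\<close> becomes one on the quadratic form
  through the Cauchy-Schwarz inequality for the form \<open>(A x, y)\<close>: for \<open>h = B k\<close>,
  \<open>\<parallel>h\<parallel>\<^sup>4 = (A k, h)\<^sup>2 \<le> (A k, k) (A h, h) = (h, k) (A h, h) \<le> C \<parallel>h\<parallel>\<^sup>2 (A h, h)\<close>
  (\<open>bounded_inverse_imp_coercive\<close>).
\<close>

section \<open>Positive and coercive operators\<close>

text \<open>The quadratic polynomial \<open>t \<mapsto> (A (x - t y), x - t y)\<close> is nonnegative; evaluate it at its minimum.\<close>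

lemma nonneg_self_adjoint_Cauchy_Schwarz:
  fixes A :: "'a::real_inner \<Rightarrow> 'a"
  assumes "linear A" and sa: "self_adjoint A" and nn: "nonneg_op A"
  shows "(A x \<bullet> y)\<^sup>2 \<le> (A x \<bullet> x) * (A y \<bullet> y)"
proof -
  define a b c where "a = A x \<bullet> x" and "b = A x \<bullet> y" and "c = A y \<bullet> y"
  have b': "A y \<bullet> x = b"
    using sa unfolding b_def self_adjoint_def by (metis inner_commute)
  have quad: "0 \<le> a - 2 * t * b + t\<^sup>2 * c" for t
  proof -
    have "0 \<le> A (x - t *\<^sub>R y) \<bullet> (x - t *\<^sub>R y)"
      using nn by (simp add: nonneg_op_def)
    also have "\<dots> = a - 2 * t * b + t\<^sup>2 * c"
      using b' by (simp add: linear_diff[OF \<open>linear A\<close>] linear_scale[OF \<open>linear A\<close>] inner_diff_left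
          inner_diff_right a_def b_def c_def power2_eq_square algebra_simps)
    finally show ?thesis .
  qed
  have "b\<^sup>2 \<le> a * c"
  proof (cases "c = 0")
    case True
    have "b = 0"
    proof (rule ccontr)
      assume "b \<noteq> 0"
      \<comment> \<open>Here the polynomial is affine in \<open>t\<close>, and this value of \<open>t\<close> makes it \<open>-1\<close>.\<close>
      then show False
        using quad[of "(a + 1) / (2 * b)"] True by simp
    qed
    then show ?thesis using True by simp
  next
    case False
    then have "c > 0"
      using nn by (simp add: c_def nonneg_op_def less_le)
    have "0 \<le> a - b\<^sup>2 / c"
      using quad[of "b / c"] False by (simp add: power2_eq_square)
    then show ?thesis
      using \<open>c > 0\<close> by (simp add: field_simps)
  qed
  then show ?thesis by (simp add: a_def b_def c_def)
qed

text \<open>Cauchy-Schwarz with \<open>y = A x\<close> gives \<open>\<parallel>A x\<parallel>\<^sup>4 \<le> 0\<close>.\<close>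

lemma nonneg_self_adjoint_eq_0:
  assumes "linear A" "self_adjoint A" "nonneg_op A" and "A x \<bullet> x = 0"
  shows "A x = 0"
  using nonneg_self_adjoint_Cauchy_Schwarz[OF assms(1-3), of x "A x"] assms(4) by simp

lemma subspace_closure:
  fixes S :: "'a::real_normed_vector set"
  assumes "subspace S"
  shows "subspace (closure S)"
proof (rule subspaceI)
  show "0 \<in> closure S"
    using assms closure_subset subspace_0 by blast
next
  fix x y assume "x \<in> closure S" "y \<in> closure S"
  then have "x + y \<in> closure (S + S)"
    using closure_sum by blast
  moreover have "S + S \<subseteq> S"
    using assms by (auto elim!: set_plus_elim intro: subspace_add)
  ultimately show "x + y \<in> closure S"
    using closure_mono by blast
next
  fix c :: real and x assume "x \<in> closure S"
  then have "c *\<^sub>R x \<in> closure ((*\<^sub>R) c ` S)"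
    by (auto simp flip: closure_scaleR)
  moreover have "(*\<^sub>R) c ` S \<subseteq> S"
    using assms by (auto intro: subspace_scale)
  ultimately show "c *\<^sub>R x \<in> closure S"
    using closure_mono by blast
qed

text \<open>The Lax-Milgram theorem on a complete subspace. For a small step \<open>t\<close> the map
  \<open>h \<mapsto> h - t (B h - m)\<close> is a contraction: coercivity makes the term of first order in \<open>t\<close> decrease
  the squared norm, and boundedness of \<open>B\<close> controls the term of second order. Its fixed point solves
  the equation.\<close>

lemma coercive_imp_surj_on:
  fixes B :: "'a::real_inner \<Rightarrow> 'a"
  assumes "bounded_linear B" "subspace K" "complete K"
    and into: "B ` K \<subseteq> K" and "0 < c"
    and coer: "\<And>x. x \<in> K \<Longrightarrow> c * (norm x)\<^sup>2 \<le> B x \<bullet> x"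
    and "m \<in> K"
  shows "\<exists>h\<in>K. B h = m"
proof -
  interpret B: bounded_linear B by fact
  obtain L0 where L0: "\<And>x. norm (B x) \<le> norm x * L0"
    using B.bounded by blast
  \<comment> \<open>A bound larger than \<open>c\<close> ensures \<open>0 \<le> q\<close> for the contraction factor \<open>sqrt q\<close>.\<close>
  define L where "L = max L0 (c + 1)"
  have "c < L" "0 < L" using \<open>0 < c\<close> by (auto simp: L_def)
  have L: "norm (B x) \<le> L * norm x" for x
    using L0[of x] mult_left_mono[of L0 L "norm x"] by (simp add: L_def mult.commute)
  \<comment> \<open>The step size minimises \<open>1 - 2 * t * c + t\<^sup>2 * L\<^sup>2\<close>.\<close>
  define t where "t = c / L\<^sup>2"
  define q where "q = 1 - (c / L)\<^sup>2"
  have t: "t > 0" and "0 \<le> q" "q < 1"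
    using \<open>0 < c\<close> \<open>c < L\<close> by (auto simp: t_def q_def power_le_one)
  have contr: "norm (x - t *\<^sub>R B x) \<le> sqrt q * norm x" if "x \<in> K" for x
  proof -
    have "(norm (x - t *\<^sub>R B x))\<^sup>2 = (norm x)\<^sup>2 - 2 * t * (B x \<bullet> x) + t\<^sup>2 * (norm (B x))\<^sup>2"
      by (simp only: power2_norm_eq_inner)
         (simp add: inner_diff_left inner_diff_right inner_commute power2_eq_square algebra_simps)
    also have "\<dots> \<le> (norm x)\<^sup>2 - 2 * t * (c * (norm x)\<^sup>2) + t\<^sup>2 * (L * norm x)\<^sup>2"
      using coer[OF that] t L[of x] by (intro add_mono diff_mono mult_left_mono power_mono) auto
    also have "\<dots> = (1 - 2 * t * c + t\<^sup>2 * L\<^sup>2) * (norm x)\<^sup>2"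
      by (simp add: algebra_simps power_mult_distrib)
    also have "1 - 2 * t * c + t\<^sup>2 * L\<^sup>2 = q"
      using \<open>0 < L\<close> by (simp add: t_def q_def field_simps power2_eq_square)
    also have "q * (norm x)\<^sup>2 = (sqrt q * norm x)\<^sup>2"
      using \<open>0 \<le> q\<close> by (simp add: power_mult_distrib)
    finally show ?thesis
      by (rule power2_le_imp_le) (use \<open>0 \<le> q\<close> in simp)
  qed
  have "\<exists>!h\<in>K. h - t *\<^sub>R (B h - m) = h"
  proof (rule Banach_fix[OF \<open>complete K\<close>, of "sqrt q"])
    show "K \<noteq> {}" using \<open>m \<in> K\<close> by auto
    show "(\<lambda>h. h - t *\<^sub>R (B h - m)) ` K \<subseteq> K"
      using into \<open>m \<in> K\<close> \<open>subspace K\<close> by (auto intro!: subspace_diff subspace_scale)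
    fix x y assume "x \<in> K" "y \<in> K"
    then have "norm ((x - y) - t *\<^sub>R B (x - y)) \<le> sqrt q * norm (x - y)"
      using \<open>subspace K\<close> by (intro contr subspace_diff)
    then show "dist (x - t *\<^sub>R (B x - m)) (y - t *\<^sub>R (B y - m)) \<le> sqrt q * dist x y"
      by (simp add: dist_norm B.diff algebra_simps)
  qed (use \<open>0 \<le> q\<close> \<open>q < 1\<close> in auto)
  then show ?thesis using t by auto
qed

section \<open>Normal solutions\<close>

locale projected_problem =
  fixes A P :: "'a::{real_inner, complete_space} \<Rightarrow> 'a"
  assumes projector: "orthogonal_projector P"
    and bounded: "bounded_linear A" and sa: "self_adjoint A" and nonneg: "nonneg_op A"
begin

abbreviation "Q \<equiv> perp_proj P"
abbreviation "M \<equiv> perp_proj P ` range A"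

sublocale A: bounded_linear A by (fact bounded)

sublocale P: bounded_linear P
  using projector by (simp add: orthogonal_projector_def)

sublocale Q: bounded_linear Q
  unfolding perp_proj_def by (intro bounded_linear_sub bounded_linear_ident P.bounded_linear_axioms)

lemma P_P [simp]: "P (P x) = P x"
  using projector by (simp add: orthogonal_projector_def fun_eq_iff)

lemma P_Q [simp]: "P (Q x) = 0" and Q_P [simp]: "Q (P x) = 0" and Q_Q [simp]: "Q (Q x) = Q x"
  by (simp_all add: perp_proj_def P.diff)

lemma decomp: "P x + Q x = x"
  by (simp add: perp_proj_def)

text \<open>\<open>Q y\<close> lies in the null space of \<open>P\<close>, and the range of \<open>P\<close> is its orthogonal complement.\<close>

lemma inner_P_Q [simp]: "P x \<bullet> Q y = 0"
proof -
  have "P x \<in> orthogonal_comp (null_space P)"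
    using projector by (auto simp: orthogonal_projector_def)
  then have "Q y \<bullet> P x = 0"
    by (simp add: orthogonal_comp_def null_space_def orthogonal_def)
  then show ?thesis by (simp add: inner_commute)
qed

lemma inner_Q_P [simp]: "Q x \<bullet> P y = 0"
  by (metis inner_P_Q inner_commute)

lemma Q_self_adjoint: "Q x \<bullet> y = x \<bullet> Q y"
  by (metis decomp inner_P_Q inner_Q_P add.left_neutral inner_add_left inner_add_right)

lemma norm_decomp: "(norm x)\<^sup>2 = (norm (P x))\<^sup>2 + (norm (Q x))\<^sup>2"
  by (subst decomp[of x, symmetric]) (simp add: power2_norm_eq_inner inner_add_left inner_add_right)

lemma norm_P_le: "norm (P x) \<le> norm x"
  by (rule power2_le_imp_le) (simp_all add: norm_decomp[of x])

lemma subspace_M: "subspace M"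
  by (intro linear_subspace_image Q.linear A.linear subspace_UNIV)

lemma Q_of_M: "x \<in> M \<Longrightarrow> Q x = x"
  by auto

text \<open>\<open>Q\<close> annihilates the part of the data in the range of \<open>P\<close>.\<close>

lemma Q_in_M_of_data:
  assumes "g \<in> range A + range P"
  shows "Q g \<in> M"
  using assms by (auto elim!: set_plus_elim simp: Q.add)

lemma is_solution_iff: "is_solution A P f g \<sigma> \<longleftrightarrow> P \<sigma> = P f \<and> Q (A \<sigma>) = Q g"
  by (auto simp: is_solution_def P.diff Q.diff)

lemma is_solution_diff:
  assumes "is_solution A P f g \<sigma>" "is_solution A P f' g' \<tau>"
  shows "is_solution A P (f - f') (g - g') (\<sigma> - \<tau>)"
  using assms by (simp add: is_solution_iff P.diff Q.diff A.diff)

text \<open>Since \<open>d = Q d\<close>, the form \<open>(A d, d) = (Q A d, d)\<close> vanishes, which for \<open>A \<ge> 0\<close> forces \<open>A d = 0\<close>.\<close>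

lemma homogeneous_solution:
  assumes "is_solution A P 0 0 d"
  shows "P d = 0" "A d = 0"
proof -
  have d: "P d = 0" "Q (A d) = 0"
    using assms by (auto simp: is_solution_iff P.zero Q.zero)
  have "A d \<bullet> d = A d \<bullet> Q d"
    using d(1) by (simp add: perp_proj_def)
  also have "\<dots> = 0"
    using d(2) by (simp flip: Q_self_adjoint)
  finally show "A d = 0"
    by (rule nonneg_self_adjoint_eq_0[OF A.linear sa nonneg])
qed (use assms in \<open>simp add: is_solution_iff P.zero\<close>)

text \<open>The null space of \<open>A\<close> is orthogonal to its range, and \<open>d = Q d\<close> is orthogonal to the range of \<open>P\<close>,
  so \<open>d\<close> is orthogonal to both components of \<open>s\<close>.\<close>

lemma homogeneous_solution_orthogonal:
  assumes "is_solution A P 0 0 d" "Q s \<in> M"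
  shows "d \<bullet> s = 0"
proof -
  note d = homogeneous_solution[OF assms(1)]
  have Qd: "Q d = d" using d(1) by (simp add: perp_proj_def)
  obtain x where x: "Q s = Q (A x)" using assms(2) by auto
  have "d \<bullet> s = d \<bullet> A x"
    by (metis Qd Q_self_adjoint x)
  also have "\<dots> = A d \<bullet> x"
    using sa by (simp add: self_adjoint_def)
  finally show ?thesis using d(2) by simp
qed

text \<open>Any other solution differs from \<open>s\<close> by a homogeneous solution, which is orthogonal to \<open>s\<close>, so by
  Pythagoras it is strictly longer. The forward direction uses this to recognise
  the solution it constructs, the converse to see that \<open>k \<in> M\<close> is the normal solution for data \<open>Q A k\<close>.\<close>

lemma is_normal_solution_iff_eq:
  assumes sol: "is_solution A P f g s" and "Q s \<in> M"
  shows "is_normal_solution A P f g \<tau> \<longleftrightarrow> \<tau> = s"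
proof -
  have pyth: "(norm \<tau>)\<^sup>2 = (norm s)\<^sup>2 + (norm (\<tau> - s))\<^sup>2" if "is_solution A P f g \<tau>" for \<tau>
  proof -
    have "is_solution A P 0 0 (\<tau> - s)"
      using is_solution_diff[OF that sol] by simp
    then have "(\<tau> - s) \<bullet> s = 0"
      using \<open>Q s \<in> M\<close> by (rule homogeneous_solution_orthogonal)
    then show ?thesis
      by (simp add: power2_norm_eq_inner inner_diff_left inner_diff_right inner_commute)
  qed
  have least: "norm s \<le> norm \<tau>" if "is_solution A P f g \<tau>" for \<tau>
    using pyth[OF that] by (auto intro: power2_le_imp_le[OF _ norm_ge_zero])
  show ?thesis
  proof
    assume "is_normal_solution A P f g \<tau>"
    then have \<tau>: "is_solution A P f g \<tau>" "norm \<tau> \<le> norm s"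
      using sol by (auto simp: is_normal_solution_def is_arg_min_linorder)
    then have "(norm \<tau>)\<^sup>2 \<le> (norm s)\<^sup>2"
      by (simp add: power_mono)
    then show "\<tau> = s" using pyth[OF \<tau>(1)] by simp
  next
    assume "\<tau> = s"
    then show "is_normal_solution A P f g \<tau>"
      using sol least by (simp add: is_normal_solution_def is_arg_min_linorder)
  qed
qed

lemma normal_solution_eq:
  assumes "is_solution A P f g s" "Q s \<in> M"
  shows "normal_solution A P f g = s"
  unfolding normal_solution_def is_normal_solution_iff_eq[OF assms] by simp

section \<open>Sufficiency of coercivity\<close>

text \<open>Test the equation \<open>Q A (Q s) = Q (g - A P f)\<close> with \<open>Q s\<close>.\<close>

lemma coercive_solution_bound:
  assumes "0 < \<rho>" and coer: "coercive_on A M \<rho>"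
    and sol: "is_solution A P f g s" and "Q s \<in> M"
  shows "(norm s)\<^sup>2 \<le> (norm f)\<^sup>2 + \<rho>\<^sup>2 * (norm (g - A (P f)))\<^sup>2"
proof -
  have s: "P s = P f" "Q (A s) = Q g"
    using sol by (auto simp: is_solution_iff)
  have "Q s = s - P f" using s by (simp add: perp_proj_def)
  then have Q_A: "Q (A (Q s)) = Q (g - A (P f))"
    using s by (simp add: A.diff Q.diff)
  have "1 / \<rho> * (norm (Q s))\<^sup>2 \<le> A (Q s) \<bullet> Q s"
    using coer \<open>Q s \<in> M\<close> unfolding coercive_on_def by blast
  also have "\<dots> = (g - A (P f)) \<bullet> Q s"
    by (metis Q_A Q_Q Q_self_adjoint)
  also have "\<dots> \<le> norm (g - A (P f)) * norm (Q s)"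
    by (rule norm_cauchy_schwarz)
  finally have "norm (Q s) * norm (Q s) \<le> norm (Q s) * (\<rho> * norm (g - A (P f)))"
    using \<open>0 < \<rho>\<close> by (simp add: field_simps power2_eq_square)
  then have "norm (Q s) \<le> \<rho> * norm (g - A (P f))"
    using \<open>0 < \<rho>\<close> by (cases "norm (Q s) = 0") (auto simp: mult_le_cancel_left)
  then have "(norm (Q s))\<^sup>2 \<le> \<rho>\<^sup>2 * (norm (g - A (P f)))\<^sup>2"
    by (metis norm_ge_zero power_mono power_mult_distrib)
  moreover have "(norm (P s))\<^sup>2 \<le> (norm f)\<^sup>2"
    by (simp add: s norm_P_le power_mono)
  ultimately show ?thesis
    using norm_decomp[of s] by linarith
qed

text \<open>\<open>M\<close> need not be complete a priori, so the Lax-Milgram lemma is applied on its closure; coercivity and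
  the identity \<open>Q x = x\<close> extend there by continuity.\<close>

lemma coercive_imp_surj_on_M:
  assumes "0 < \<rho>" and coer: "coercive_on A M \<rho>" and "m \<in> M"
  shows "\<exists>h\<in>M. Q (A h) = m"
proof -
  let ?K = "closure M"
  have "?K \<subseteq> {x. Q x = x}"
    by (intro closure_minimal closed_Collect_eq Q.continuous_on continuous_on_id)
       (use Q_of_M in blast)
  moreover have "?K \<subseteq> {x. 1 / \<rho> * (norm x)\<^sup>2 \<le> A x \<bullet> x}"
    by (intro closure_minimal closed_Collect_le continuous_intros A.continuous_on)
       (use coer in \<open>auto simp: coercive_on_def\<close>)
  ultimately have fix_coer: "Q x = x" "1 / \<rho> * (norm x)\<^sup>2 \<le> A x \<bullet> x" if "x \<in> ?K" for x
    using that by blast+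
  have coer': "1 / \<rho> * (norm x)\<^sup>2 \<le> Q (A x) \<bullet> x" if "x \<in> ?K" for x
    unfolding Q_self_adjoint using fix_coer[OF that] by simp
  have solve: "\<exists>h\<in>?K. Q (A h) = k" if "k \<in> ?K" for k
  proof (rule coercive_imp_surj_on[where c = "1 / \<rho>"])
    show "bounded_linear (\<lambda>x. Q (A x))"
      by (intro bounded_linear_compose[OF Q.bounded_linear_axioms] bounded)
    show "subspace ?K" by (rule subspace_closure[OF subspace_M])
    show "complete ?K" by (simp add: complete_eq_closed)
    show "(\<lambda>x. Q (A x)) ` ?K \<subseteq> ?K"
      by (rule image_subsetI, rule subsetD[OF closure_subset]) blast
  qed (use \<open>0 < \<rho>\<close> that coer' in auto)
  \<comment> \<open>Solving once more with right-hand side \<open>h\<close> shows that \<open>h\<close> lies in \<open>M\<close> itself.\<close>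
  obtain h where "h \<in> ?K" "Q (A h) = m"
    using solve[OF subsetD[OF closure_subset \<open>m \<in> M\<close>]] by blast
  moreover have "h \<in> M"
    using solve[OF \<open>h \<in> ?K\<close>] by auto
  ultimately show ?thesis by blast
qed

lemma coercive_imp_solution:
  assumes "0 < \<rho>" "coercive_on A M \<rho>" and "g \<in> range A + range P"
  obtains s where "is_solution A P f g s" "Q s \<in> M"
proof -
  have "Q g - Q (A (P f)) \<in> M"
    by (rule subspace_diff[OF subspace_M Q_in_M_of_data[OF assms(3)]]) blast
  then obtain h where h: "h \<in> M" "Q (A h) = Q g - Q (A (P f))"
    using coercive_imp_surj_on_M[OF assms(1,2)] by blast
  have "Q h = h" using h(1) by (rule Q_of_M)
  moreover from this have "P h = 0" by (metis P_Q)
  ultimately show thesis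
    using h by (intro that[of "P f + h"]) (auto simp: is_solution_iff P.add A.add Q.add)
qed

text \<open>The difference of two normal solutions is a solution for the difference of the data and again has its
  \<open>Q\<close>-component in the subspace \<open>M\<close>, so the norm bound turns into a modulus of continuity.\<close>

lemma coercive_imp_continuous:
  assumes "0 < \<rho>" "coercive_on A M \<rho>"
  shows "continuous_on (UNIV \<times> (range A + range P)) (\<lambda>(f, g). normal_solution A P f g)"
proof -
  let ?S = "(UNIV :: 'a set) \<times> (range A + range P)"
  let ?F = "\<lambda>(f, g). normal_solution A P f g"
  have bound: "norm (?F z - ?F w) \<le>
      sqrt ((norm (fst z - fst w))\<^sup>2 + \<rho>\<^sup>2 * (norm (snd z - snd w - A (P (fst z - fst w))))\<^sup>2)"
    if zw: "z \<in> ?S" "w \<in> ?S" for z w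
  proof -
    obtain f g f' g' where eq: "z = (f, g)" "w = (f', g')" by (metis surj_pair)
    obtain s where s: "is_solution A P f g s" "Q s \<in> M"
      using coercive_imp_solution[OF assms, of g f] zw eq by auto
    obtain s' where s': "is_solution A P f' g' s'" "Q s' \<in> M"
      using coercive_imp_solution[OF assms, of g' f'] zw eq by auto
    have "Q (s - s') \<in> M"
      unfolding Q.diff using s(2) s'(2) by (intro subspace_diff subspace_M)
    from coercive_solution_bound[OF assms is_solution_diff[OF s(1) s'(1)] this]
    show ?thesis
      by (simp add: eq normal_solution_eq[OF s] normal_solution_eq[OF s'] real_le_rsqrt)
  qed
  show ?thesis
    unfolding continuous_on_def
  proof
    fix w assume w: "w \<in> ?S"
    let ?b = "\<lambda>z. sqrt ((norm (fst z - fst w))\<^sup>2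
      + \<rho>\<^sup>2 * (norm (snd z - snd w - A (P (fst z - fst w))))\<^sup>2)"
    have "continuous_on UNIV (?b :: 'a \<times> 'a \<Rightarrow> real)"
      by (intro continuous_intros A.continuous_on P.continuous_on)
    then have "(?b \<longlongrightarrow> ?b w) (at w within ?S)"
      by (meson UNIV_I continuous_on_def subset_UNIV tendsto_within_subset)
    then have "(?b \<longlongrightarrow> 0) (at w within ?S)"
      by (simp add: A.zero P.zero)
    then have "((\<lambda>z. ?F z - ?F w) \<longlongrightarrow> 0) (at w within ?S)"
      by (rule Lim_null_comparison[rotated])
         (use bound w in \<open>auto simp: eventually_at_filter intro!: always_eventually\<close>)
    then show "(?F \<longlongrightarrow> ?F w) (at w within ?S)"
      by (rule LIM_zero_cancel)
  qed
qed

section \<open>Necessity of coercivity\<close>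

text \<open>A bounded inverse only controls \<open>\<parallel>Q A h\<parallel>\<close> from below. Writing \<open>h = Q A k\<close> and applying
  Cauchy-Schwarz for the form of \<open>A\<close> to \<open>(A k, h) = \<parallel>h\<parallel>\<^sup>2\<close> brings in \<open>(A h, h)\<close>, while the other factor
  \<open>(A k, k) = (h, k)\<close> is at most \<open>C \<parallel>h\<parallel>\<^sup>2\<close>.\<close>

lemma bounded_inverse_imp_coercive:
  assumes "0 < C" and surj: "M \<subseteq> (\<lambda>x. Q (A x)) ` M"
    and inv: "\<And>k. k \<in> M \<Longrightarrow> norm k \<le> C * norm (Q (A k))"
  shows "coercive_on A M C"
  unfolding coercive_on_def
proof
  fix h assume "h \<in> M"
  then obtain k where k: "k \<in> M" "h = Q (A k)" using surj by blast
  have "h \<bullet> h = A k \<bullet> h"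
    by (metis k(2) Q_Q Q_self_adjoint)
  have "(h \<bullet> h)\<^sup>2 \<le> (A k \<bullet> k) * (A h \<bullet> h)"
    unfolding \<open>h \<bullet> h = A k \<bullet> h\<close>
    by (intro nonneg_self_adjoint_Cauchy_Schwarz A.linear sa nonneg)
  also have "A k \<bullet> k = h \<bullet> k"
    by (metis Q_of_M Q_self_adjoint k)
  also have "(h \<bullet> k) * (A h \<bullet> h) \<le> (norm h * (C * norm h)) * (A h \<bullet> h)"
  proof (rule mult_right_mono)
    have "h \<bullet> k \<le> norm h * norm k" by (rule norm_cauchy_schwarz)
    also have "\<dots> \<le> norm h * (C * norm h)"
      using inv[OF k(1)] k(2) by (intro mult_left_mono) auto
    finally show "h \<bullet> k \<le> norm h * (C * norm h)" .
  qed (use nonneg in \<open>simp add: nonneg_op_def\<close>)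
  finally have "(norm h)\<^sup>2 * (norm h)\<^sup>2 \<le> (norm h)\<^sup>2 * (C * (A h \<bullet> h))"
    by (simp add: power2_norm_eq_inner[symmetric] power2_eq_square algebra_simps)
  then have "(norm h)\<^sup>2 \<le> C * (A h \<bullet> h)"
  proof (cases "h = 0")
    case False
    then have "0 < (norm h)\<^sup>2" by simp
    then show ?thesis
      by (rule mult_left_le_imp_le[rotated]) fact
  qed simp
  then show "1 / C * (norm h)\<^sup>2 \<le> A h \<bullet> h"
    using \<open>0 < C\<close> by (simp add: field_simps)
qed

lemma M_subset_data: "M \<subseteq> range A + range P"
proof
  fix m assume "m \<in> M"
  then obtain x where "m = A x + P (- A x)"
    by (auto simp: perp_proj_def P.neg)
  then show "m \<in> range A + range P" by blast
qed

text \<open>With \<open>f = 0\<close> the normal solution for data \<open>m \<in> M\<close> is the inverse image of \<open>m\<close> under \<open>Q A\<close> in \<open>M\<close>.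
  Continuity at the origin and homogeneity bound this inverse.\<close>

lemma well_posed_imp_coercive:
  assumes ex: "\<And>f g. g \<in> range A + range P \<Longrightarrow>
      (\<exists>!\<sigma>. is_normal_solution A P f g \<sigma>) \<and> Q (normal_solution A P f g) \<in> M"
    and cont: "continuous_on (UNIV \<times> (range A + range P)) (\<lambda>(f, g). normal_solution A P f g)"
  shows "\<exists>\<rho>>0. coercive_on A M \<rho>"
proof -
  let ?F = "normal_solution A P 0"
  have F_M: "?F m \<in> M" and F_inv: "Q (A (?F m)) = m" if "m \<in> M" for m
  proof -
    have m: "m \<in> range A + range P" using that M_subset_data by blast
    then have "\<exists>!\<sigma>. is_normal_solution A P 0 m \<sigma>" using ex by blast
    then have "is_normal_solution A P 0 m (?F m)"
      unfolding normal_solution_def by (rule theI')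
    then have "P (?F m) = 0" "Q (A (?F m)) = Q m"
      by (auto simp: is_normal_solution_def is_arg_min_linorder is_solution_iff P.zero)
    then show "Q (A (?F m)) = m" "?F m \<in> M"
      using ex[OF m, of 0] Q_of_M[OF that] by (auto simp: perp_proj_def[of P "?F m"])
  qed
  have F_image: "?F (Q (A k)) = k" if "k \<in> M" for k
  proof (rule normal_solution_eq)
    have "Q k = k" using that by (rule Q_of_M)
    moreover from this have "P k = 0" by (metis P_Q)
    ultimately show "is_solution A P 0 (Q (A k)) k" "Q k \<in> M"
      using that by (simp_all add: is_solution_iff P.zero)
  qed
  have "0 \<in> M" using subspace_M by (rule subspace_0)
  then have "?F 0 = 0"
    using F_image[of 0] by (simp add: A.zero Q.zero)
  have embed: "continuous_on M (\<lambda>m. (0 :: 'a, m))"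
    by (rule continuous_on_Pair[OF continuous_on_const continuous_on_id])
  have "(\<lambda>m. (0, m)) ` M \<subseteq> UNIV \<times> (range A + range P)"
    using M_subset_data by blast
  with continuous_on_compose2[OF cont embed] have "continuous_on M ?F"
    by simp
  then obtain d where "d > 0" and d: "\<And>m. m \<in> M \<Longrightarrow> norm m < d \<Longrightarrow> norm (?F m) < 1"
    using \<open>0 \<in> M\<close> \<open>?F 0 = 0\<close> unfolding continuous_on_iff dist_norm
    by (elim ballE[of _ _ 0] allE[of _ 1]) auto
  \<comment> \<open>Rescaling: if \<open>Q (A k)\<close> were shorter than \<open>d * norm k\<close>, the unit vector along \<open>k\<close>
      would solve a problem with data shorter than \<open>d\<close>.\<close>
  have "norm k \<le> 1 / d * norm (Q (A k))" if "k \<in> M" for k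
  proof (cases "k = 0")
    case False
    let ?u = "(1 / norm k) *\<^sub>R k"
    have u: "?u \<in> M" using that subspace_M by (intro subspace_scale)
    have "\<not> norm (Q (A ?u)) < d"
      using d[of "Q (A ?u)"] F_image[OF u] False by auto
    then show ?thesis
      using False \<open>d > 0\<close> by (simp add: A.scaleR Q.scaleR field_simps)
  qed simp
  moreover have "M \<subseteq> (\<lambda>x. Q (A x)) ` M"
  proof
    fix m assume "m \<in> M"
    then have "m = Q (A (?F m))" "?F m \<in> M"
      using F_inv F_M by simp_all
    then show "m \<in> (\<lambda>x. Q (A x)) ` M"
      by (rule image_eqI)
  qed
  ultimately have "coercive_on A M (1 / d)"
    using \<open>d > 0\<close> by (intro bounded_inverse_imp_coercive) simp_all
  then show ?thesis using \<open>d > 0\<close> by (intro exI[of _ "1 / d"]) simp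
qed

end

section \<open>The equivalence and the norm bound\<close>

theorem theorem4p3:
  fixes A P :: "'a::{real_inner, complete_space} \<Rightarrow> 'a"
  assumes "orthogonal_projector P"
    and "bounded_linear A" and "self_adjoint A" and "nonneg_op A"
  shows
    "((\<exists>\<rho>>0. coercive_on A (perp_proj P ` range A) \<rho>) \<longleftrightarrow>
        (\<forall>f. \<forall>g \<in> range A + range P.
           (\<exists>!\<sigma>. is_normal_solution A P f g \<sigma>) \<and>
           perp_proj P (normal_solution A P f g) \<in> perp_proj P ` range A) \<and>
        continuous_on (UNIV \<times> (range A + range P)) (\<lambda>(f, g). normal_solution A P f g)) \<and>
     (\<forall>\<rho>>0. coercive_on A (perp_proj P ` range A) \<rho> \<longrightarrow>
        (\<forall>f. \<forall>g \<in> range A + range P.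
           (norm (normal_solution A P f g))\<^sup>2
             \<le> (norm f)\<^sup>2 + \<rho>\<^sup>2 * (norm (g - A (P f)))\<^sup>2))"
proof -
  interpret projected_problem A P
    by (rule projected_problem.intro) fact+
  have suff: "(\<exists>!\<sigma>. is_normal_solution A P f g \<sigma>) \<and> Q (normal_solution A P f g) \<in> M \<and>
      (norm (normal_solution A P f g))\<^sup>2 \<le> (norm f)\<^sup>2 + \<rho>\<^sup>2 * (norm (g - A (P f)))\<^sup>2"
    if \<rho>: "0 < \<rho>" "coercive_on A M \<rho>" and g: "g \<in> range A + range P" for \<rho> f g
  proof -
    obtain s where s: "is_solution A P f g s" "Q s \<in> M"
      using coercive_imp_solution[OF \<rho> g] .
    then show ?thesis
      using coercive_solution_bound[OF \<rho> s] by (simp add: is_normal_solution_iff_eq normal_solution_eq)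
  qed
  show ?thesis
  proof (intro conjI iffI)
    assume "\<exists>\<rho>>0. coercive_on A M \<rho>"
    then obtain \<rho> where \<rho>: "0 < \<rho>" "coercive_on A M \<rho>" by blast
    show "\<forall>f. \<forall>g \<in> range A + range P.
        (\<exists>!\<sigma>. is_normal_solution A P f g \<sigma>) \<and> Q (normal_solution A P f g) \<in> M"
      using suff[OF \<rho>] by blast
    show "continuous_on (UNIV \<times> (range A + range P)) (\<lambda>(f, g). normal_solution A P f g)"
      using coercive_imp_continuous[OF \<rho>] .
  next
    assume "(\<forall>f. \<forall>g \<in> range A + range P.
        (\<exists>!\<sigma>. is_normal_solution A P f g \<sigma>) \<and> Q (normal_solution A P f g) \<in> M) \<and>
      continuous_on (UNIV \<times> (range A + range P)) (\<lambda>(f, g). normal_solution A P f g)"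
    then show "\<exists>\<rho>>0. coercive_on A M \<rho>"
      by (intro well_posed_imp_coercive) blast+
  next
    show "\<forall>\<rho>>0. coercive_on A M \<rho> \<longrightarrow> (\<forall>f. \<forall>g \<in> range A + range P.
        (norm (normal_solution A P f g))\<^sup>2 \<le> (norm f)\<^sup>2 + \<rho>\<^sup>2 * (norm (g - A (P f)))\<^sup>2)"
      using suff by blast
  qed
qed

end
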